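(* The family $Forb(C_4, C_5, C_6,\ldots)$ of chordal graphs is $(\delta,\chi_{FF})$-bounded with $f(x)=x+1$; that is, every chordal graph $G$ satisfies $\chi_{FF}(G)\geq \delta(G)+1$.
   Context: All graphs are finite, simple and undirected. $C_n$ is the cycle on $n$ vertices; a graph is chordal if it contains no induced cycle of length at least 4, i.e. it belongs to $Forb(C_4,C_5,\ldots)$, the class of graphs with no induced subgraph isomorphic to any $C_n$, $n\geq 4$. $\delta(G)$ is the minimum degree. A Grundy $k$-coloring of $G$ is a proper coloring with colors $\{1,\dots,k\}$ such that for any $i<j$, every vertex colored $j$ has a neighbor colored $i$; $\chi_{FF}(G)$ (the First-Fit or Grundy chromatic number) is the largest $k$ for which a Grundy $k$-coloring exists. *)

theory Defs
  imports Complex_Main "Graph_Theory.Graph_Theory"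
begin

text \<open>
  Graphs are represented by \<^locale>\<open>pair_graph\<close>: the vertex set is finite and
  the set of arcs is a symmetric irreflexive relation, so that each undirected edge appears
  as two opposite arcs. The null graph is excluded; it has no minimum degree.
\<close>

definition simple_graph :: "'a pair_pre_digraph \<Rightarrow> bool" where
  "simple_graph G \<longleftrightarrow> pair_graph G \<and> pverts G \<noteq> {}"

definition cycle_graph :: "nat \<Rightarrow> nat pair_pre_digraph" where
  "cycle_graph n =
    \<lparr> pverts = {0..<n},
      parcs = {(i, j). i < n \<and> j < n \<and> (j = Suc i mod n \<or> i = Suc j mod n)} \<rparr>"

lemma simple_graph_cycle_graph:
  assumes "n \<ge> 3"
  shows "simple_graph (cycle_graph n)"
proof -
  have verts: "pverts (cycle_graph n) = {0..<n}"
    by (simp add: cycle_graph_def)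
  have arcs: "(i, j) \<in> parcs (cycle_graph n) \<longleftrightarrow>
      i < n \<and> j < n \<and> (j = Suc i mod n \<or> i = Suc j mod n)" for i j
    by (simp add: cycle_graph_def)
  have sub: "parcs (cycle_graph n) \<subseteq> {0..<n} \<times> {0..<n}"
    by (rule subrelI) (simp add: arcs)
  have irrefl: "Suc i mod n \<noteq> i" if "i < n" for i
    using that assms by (cases "Suc i = n") auto
  have no_loop: "(i, i) \<notin> parcs (cycle_graph n)" for i
    using irrefl[of i] arcs[of i i] by argo
  have "pair_graph (cycle_graph n)"
  proof unfold_locales
    show "symmetric (with_proj (cycle_graph n))"
      unfolding symmetric_def with_proj_simps by (rule symI) (use arcs in blast)
    show "fst e \<noteq> snd e" if "e \<in> parcs (cycle_graph n)" for e
      using that no_loop by (metis prod.collapse)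
    show "fst e \<in> pverts (cycle_graph n)" "snd e \<in> pverts (cycle_graph n)"
      if "e \<in> parcs (cycle_graph n)" for e
      using that sub by (auto simp: verts)
    show "finite (pverts (cycle_graph n))" by (simp add: verts)
    show "finite (parcs (cycle_graph n))" by (rule finite_subset[OF sub]) simp
  qed
  thus ?thesis
    using assms by (auto simp: simple_graph_def verts)
qed

definition has_induced :: "'a pair_pre_digraph \<Rightarrow> 'b pair_pre_digraph \<Rightarrow> bool" where
  "has_induced G H \<longleftrightarrow>
    (\<exists>S \<subseteq> pverts G. digraph_iso (with_proj G \<restriction> S) (with_proj H))"

definition Forb :: "'b pair_pre_digraph set \<Rightarrow> 'a pair_pre_digraph set" where
  "Forb \<H> = {G. simple_graph G \<and> (\<forall>H \<in> \<H>. \<not> has_induced G H)}"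

definition chordal :: "'a pair_pre_digraph \<Rightarrow> bool" where
  "chordal G \<longleftrightarrow> G \<in> Forb {cycle_graph n | n. n \<ge> 4}"

text \<open>Since every edge is a pair of opposite arcs, the degree of a vertex is its out-degree.\<close>

definition min_degree :: "'a pair_pre_digraph \<Rightarrow> nat" where
  "min_degree G = Min (out_degree (with_proj G) ` pverts G)"

text \<open>All \<open>k\<close> colors have to be used, for otherwise \<open>k\<close> would not be bounded.\<close>

definition grundy_coloring :: "'a pair_pre_digraph \<Rightarrow> nat \<Rightarrow> ('a \<Rightarrow> nat) \<Rightarrow> bool" where
  "grundy_coloring G k c \<longleftrightarrow>
    c ` pverts G = {1..k} \<and>
    (\<forall>(u, v) \<in> parcs G. c u \<noteq> c v) \<and>
    (\<forall>i j. 1 \<le> i \<and> i < j \<longrightarrow>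
      (\<forall>v \<in> pverts G. c v = j \<longrightarrow> (\<exists>u \<in> pverts G. (v, u) \<in> parcs G \<and> c u = i)))"

definition chi_FF :: "'a pair_pre_digraph \<Rightarrow> nat" where
  "chi_FF G = Max {k. \<exists>c. grundy_coloring G k c}"

text \<open>The maximum is taken over a finite nonempty set.\<close>

lemma finite_grundy_numbers:
  assumes "simple_graph G"
  shows "finite {k. \<exists>c. grundy_coloring G k c}"
proof (rule finite_subset)
  from assms have fin: "finite (pverts G)"
    by (simp add: simple_graph_def pair_graph_def pair_digraph_def pair_fin_digraph_def
        pair_fin_digraph_axioms_def)
  show "{k. \<exists>c. grundy_coloring G k c} \<subseteq> {..card (pverts G)}"
  proof clarify
    fix k c assume "grundy_coloring G k c"
    hence "card (c ` pverts G) = k" by (simp add: grundy_coloring_def)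
    thus "k \<le> card (pverts G)" using card_image_le[OF fin, of c] by simp
  qed
qed simp

lemma grundy_coloring_exists:
  assumes "simple_graph G"
  shows "\<exists>k c. grundy_coloring G k c"
proof -
  interpret pair_graph G using assms by (simp add: simple_graph_def)
  let ?E = "parcs G"
  have ex: "\<exists>(k::nat) c. c ` S = {1..k} \<and> (\<forall>u\<in>S. \<forall>v\<in>S. (u, v) \<in> ?E \<longrightarrow> c u \<noteq> c v) \<and>
      (\<forall>v\<in>S. \<forall>i. 1 \<le> i \<and> i < c v \<longrightarrow> (\<exists>u\<in>S. (v, u) \<in> ?E \<and> c u = i))"
    if "finite S" for S
    using that
  proof (induction S rule: finite_induct)
    case empty
    show ?case by (rule exI[of _ 0]) auto
  next
    case (insert x S)
    from insert.IH obtain k :: nat and c where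
      im: "c ` S = {1..k}" and
      proper0: "\<forall>u\<in>S. \<forall>v\<in>S. (u, v) \<in> ?E \<longrightarrow> c u \<noteq> c v" and
      gr0: "\<forall>v\<in>S. \<forall>i. 1 \<le> i \<and> i < c v \<longrightarrow> (\<exists>u\<in>S. (v, u) \<in> ?E \<and> c u = i)"
      by (elim exE conjE)
    note proper = proper0[rule_format]
    have gr: "\<exists>u\<in>S. (v, u) \<in> ?E \<and> c u = i" if "v \<in> S" "1 \<le> i" "i < c v" for v i
      using gr0 that by simp
    define P where "P i \<longleftrightarrow> 1 \<le> i \<and> i \<notin> c ` {u \<in> S. (x, u) \<in> ?E}" for i
    define m where "m = (LEAST i. P i)"
    have "c ` {u \<in> S. (x, u) \<in> ?E} \<subseteq> {1..k}" unfolding im[symmetric] by (rule image_mono) simp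
    hence Pk: "P (Suc k)" unfolding P_def by (simp add: subset_eq) force
    have Pm: "P m" unfolding m_def by (rule LeastI[of P, OF Pk])
    have mk: "m \<le> Suc k" unfolding m_def by (rule Least_le[of P, OF Pk])
    have below: "\<exists>u\<in>S. (x, u) \<in> ?E \<and> c u = i" if "1 \<le> i" "i < m" for i
      using not_less_Least[of i P] that unfolding m_def P_def by auto
    let ?d = "c(x := m)"
    have same: "?d u = c u" if "u \<in> S" for u using that insert.hyps by auto
    have "?d ` S = c ` S" by (rule image_cong[OF refl same])
    hence "?d ` insert x S = insert m {1..k}" by (simp only: image_insert fun_upd_same im)
    moreover have "insert m {1..k} = {1..max k m}"
      using mk Pm by (cases "m = Suc k") (auto simp: P_def)
    ultimately have im': "?d ` insert x S = {1..max k m}" by (rule trans)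
    have new: "c u \<noteq> m" if "u \<in> S" "(x, u) \<in> ?E" for u
      using Pm that by (auto simp: P_def)
    have proper': "?d u \<noteq> ?d v" if "u \<in> insert x S" "v \<in> insert x S" "(u, v) \<in> ?E" for u v
    proof (cases "u = x")
      case True
      then have v: "v \<in> S" using that no_loops'[OF that(3)] by auto
      show ?thesis using True new[of v] v that(3) same[OF v] by simp
    next
      case False
      then have u: "u \<in> S" using that by auto
      show ?thesis
      proof (cases "v = x")
        case True
        show ?thesis using True new[of u] u arcs_symmetric[OF that(3)] same[OF u] by simp
      next
        case False
        then have v: "v \<in> S" using that by auto
        show ?thesis using proper[OF u v that(3)] same[OF u] same[OF v] by simp
      qed
    qed
    have gr': "\<exists>u\<in>insert x S. (v, u) \<in> ?E \<and> ?d u = i"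
      if v: "v \<in> insert x S" and i: "1 \<le> i" "i < ?d v" for v i
    proof (cases "v = x")
      case True
      then obtain w where w: "w \<in> S" "(x, w) \<in> ?E" "c w = i" using below[of i] i by auto
      have "?d w = i" using same[OF w(1)] w(3) by (rule trans)
      then show ?thesis using w(1,2) True by blast
    next
      case False
      then have vS: "v \<in> S" using v by auto
      obtain w where w: "w \<in> S" "(v, w) \<in> ?E" "c w = i"
        using gr[OF vS i(1)] i(2) same[OF vS] by auto
      have "?d w = i" using same[OF w(1)] w(3) by (rule trans)
      then show ?thesis using w(1,2) by blast
    qed
    show ?case
    proof (intro exI conjI ballI allI impI)
      show "?d ` insert x S = {1..max k m}" by (rule im')
      show "?d u \<noteq> ?d v" if "u \<in> insert x S" "v \<in> insert x S" "(u, v) \<in> ?E" for u v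
        using that by (rule proper')
      show "\<exists>u\<in>insert x S. (v, u) \<in> ?E \<and> ?d u = i"
        if "v \<in> insert x S" "1 \<le> i \<and> i < ?d v" for v i
        using gr'[of v i] that by blast
    qed
  qed
  obtain k :: nat and c where *: "c ` pverts G = {1..k}"
      "\<forall>u\<in>pverts G. \<forall>v\<in>pverts G. (u, v) \<in> ?E \<longrightarrow> c u \<noteq> c v"
      "\<forall>v\<in>pverts G. \<forall>i. 1 \<le> i \<and> i < c v \<longrightarrow> (\<exists>u\<in>pverts G. (v, u) \<in> ?E \<and> c u = i)"
    using ex[OF pair_finite_verts] by (elim exE conjE)
  have "grundy_coloring G k c"
    unfolding grundy_coloring_def
  proof (intro conjI)
    show "\<forall>(u, v)\<in>?E. c u \<noteq> c v" using *(2) in_arcsD1 in_arcsD2 by blast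
    show "\<forall>i j. 1 \<le> i \<and> i < j \<longrightarrow>
      (\<forall>v\<in>pverts G. c v = j \<longrightarrow> (\<exists>u\<in>pverts G. (v, u) \<in> ?E \<and> c u = i))"
      using *(3) by blast
  qed (rule *(1))
  thus ?thesis by blast
qed

definition delta_FF_bounded_by :: "(nat \<Rightarrow> nat) \<Rightarrow> 'a pair_pre_digraph set \<Rightarrow> bool" where
  "delta_FF_bounded_by f \<F> \<longleftrightarrow>
    filterlim f at_top at_top \<and> (\<forall>G \<in> \<F>. f (min_degree G) \<le> chi_FF G)"

end

(*
  A chordal graph has a simplicial vertex v (Dirac). The closed neighbourhood of v is a clique
  with at least delta + 1 vertices, and a Grundy coloring, being proper, needs that many colors.

  Simplicial vertices are found by induction on the vertex set, in the stronger form that some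
  simplicial vertex is distinct from and not adjacent to a prescribed non-universal vertex x.
  Let C be a component of the graph without x and its neighbours, and let T be the set of
  neighbours of x with a neighbour in C. Then T is a clique: two non-adjacent vertices of T are
  joined by a shortest path through C, and x closes this path to an induced cycle. In the smaller
  graph on C \<union> T the induction hypothesis provides a simplicial vertex in C, and all neighbours
  of vertices in C lie in C \<union> T.
*)
theory Submission
  imports Defs
begin

section \<open>Induced cycles, cliques and simplicial vertices of an edge relation\<close>

text \<open>Stated for a bare relation and not for a vertex set: an induction over vertex sets can
  then keep \<open>E\<close> fixed, and the absence of long induced cycles needs no transfer to
  subgraphs.\<close>

definition induced_cycle :: "'a rel \<Rightarrow> nat \<Rightarrow> (nat \<Rightarrow> 'a) \<Rightarrow> bool" where
  "induced_cycle E n g \<longleftrightarrow> inj_on g {0..<n} \<and>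
    (\<forall>i<n. \<forall>j<n. (g i, g j) \<in> E \<longleftrightarrow> j = Suc i mod n \<or> i = Suc j mod n)"

definition clique :: "'a rel \<Rightarrow> 'a set \<Rightarrow> bool" where
  "clique E K \<longleftrightarrow> (\<forall>u\<in>K. \<forall>v\<in>K. u \<noteq> v \<longrightarrow> (u, v) \<in> E)"

definition simplicial :: "'a rel \<Rightarrow> 'a set \<Rightarrow> 'a \<Rightarrow> bool" where
  "simplicial E W v \<longleftrightarrow> v \<in> W \<and> clique E (W \<inter> E `` {v})"

lemma cliqueD: "clique E K \<Longrightarrow> u \<in> K \<Longrightarrow> v \<in> K \<Longrightarrow> u \<noteq> v \<Longrightarrow> (u, v) \<in> E"
  by (auto simp: clique_def)

lemma clique_subset: "clique E K \<Longrightarrow> L \<subseteq> K \<Longrightarrow> clique E L"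
  by (auto simp: clique_def)

section \<open>Shortest paths and the cycles they close\<close>

text \<open>In a walk of least length a repeated vertex or a forward chord would give a shorter
  walk.\<close>

lemma shortest_path:
  assumes "(u, w) \<in> R\<^sup>*"
  obtains f m where "f 0 = u" "f m = w" "\<And>i. i < m \<Longrightarrow> (f i, f (Suc i)) \<in> R"
    "inj_on f {..m}" "\<And>i j. i < j \<Longrightarrow> j \<le> m \<Longrightarrow> (f i, f j) \<in> R \<Longrightarrow> j = Suc i"
proof -
  define m where "m = (LEAST n. (u, w) \<in> R ^^ n)"
  have "\<exists>n. (u, w) \<in> R ^^ n" using assms by (simp add: rtrancl_power)
  then have "(u, w) \<in> R ^^ m" unfolding m_def by (rule LeastI_ex)
  then obtain f where f: "f 0 = u" "f m = w" "\<forall>i<m. (f i, f (Suc i)) \<in> R"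
    unfolding relpow_fun_conv by blast
  have least: "m \<le> n" if "(u, w) \<in> R ^^ n" for n
    unfolding m_def using that by (rule Least_le)
  have seg: "(f i, f j) \<in> R ^^ (j - i)" if "i \<le> j" "j \<le> m" for i j
    unfolding relpow_fun_conv
    by (rule exI[of _ "\<lambda>k. f (i + k)"]) (use f(3) that in auto)
  \<comment> \<open>Replacing the segment from \<open>i\<close> to \<open>j\<close> by
    \<open>d\<close> steps gives a walk again; \<open>d = 0\<close> will exclude repeated vertices,
    \<open>d = 1\<close> chords.\<close>
  have shortcut: "m \<le> i + d + (m - j)" if "i \<le> m" "j \<le> m" "(f i, f j) \<in> R ^^ d" for i j d
  proof (rule least)
    have "(u, f i) \<in> R ^^ i" "(f j, w) \<in> R ^^ (m - j)"
      using seg[of 0 i] seg[of j m] that f by auto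
    then show "(u, w) \<in> R ^^ (i + d + (m - j))"
      using that(3) unfolding relpow_add by blast
  qed
  have "f i \<noteq> f j" if "i < j" "j \<le> m" for i j
    using shortcut[of i j 0] that by auto
  then have "inj_on f {..m}"
    by (intro linorder_inj_onI) auto
  moreover have "j = Suc i" if "i < j" "j \<le> m" "(f i, f j) \<in> R" for i j
    using shortcut[of i j 1] that by auto
  ultimately show thesis using f that by blast
qed

text \<open>With \<open>x\<close> at position \<open>m + 1\<close>, the wrap-around modulo
  \<open>m + 2\<close> yields exactly the two edges from \<open>x\<close> to the ends of the path.
  The bound on \<open>m\<close> makes the cycle length at least 4.\<close>

lemma induced_cycle_close_path:
  assumes "sym E" "irrefl E" "inj_on f {..m}" "2 \<le> m"
    and path: "\<And>i j. i < j \<Longrightarrow> j \<le> m \<Longrightarrow> (f i, f j) \<in> E \<longleftrightarrow> j = Suc i"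
    and x: "\<And>i. i \<le> m \<Longrightarrow> f i \<noteq> x"
    and x_adj: "\<And>i. i \<le> m \<Longrightarrow> (x, f i) \<in> E \<longleftrightarrow> i = 0 \<or> i = m"
  shows "induced_cycle E (m + 2) (f(Suc m := x))"
proof -
  let ?g = "f(Suc m := x)"
  have symE: "(a, b) \<in> E \<longleftrightarrow> (b, a) \<in> E" for a b
    using assms(1) by (meson symD)
  have "{0..<m + 2} = insert (Suc m) {..m}" by auto
  moreover have "inj_on ?g {..m}"
    using assms(3) by (rule inj_on_cong[THEN iffD1, rotated]) auto
  moreover have "?g ` {..m} = f ` {..m}" by (rule image_cong) auto
  ultimately have "inj_on ?g {0..<m + 2}" using x by auto
  \<comment> \<open>Only the order \<open>i < j\<close> is treated here; the next claim cites it as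
    \<open>calculation(2)\<close> and adds the other cases by symmetry and irreflexivity.\<close>
  moreover have "(?g i, ?g j) \<in> E \<longleftrightarrow> j = Suc i mod (m + 2) \<or> i = Suc j mod (m + 2)"
    if "i < j" "j < m + 2" for i j
  proof (cases "j = Suc m")
    case True
    then show ?thesis using that x_adj[of i] symE[of "f i" x] by (auto simp: mod_Suc)
  next
    case False
    then show ?thesis using that path[of i j] by (auto simp: mod_Suc)
  qed
  moreover have "(?g i, ?g j) \<in> E \<longleftrightarrow> j = Suc i mod (m + 2) \<or> i = Suc j mod (m + 2)"
    if "i < m + 2" "j < m + 2" for i j
  proof (cases i j rule: linorder_cases)
    case less
    then show ?thesis using calculation(2) that by blast
  next
    case equal
    then show ?thesis using assms(2) that by (auto simp: irrefl_def mod_Suc)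
  next
    case greater
    then show ?thesis using calculation(2)[of j i] that symE[of "?g i" "?g j"] by blast
  qed
  ultimately show ?thesis unfolding induced_cycle_def by blast
qed

text \<open>A shortest path from \<open>u\<close> to \<open>w\<close> through \<open>C\<close> meets
  the neighbours of \<open>x\<close> only at its ends, so a missing edge between \<open>u\<close>
  and \<open>w\<close> would yield an induced cycle. This is the one place where the absence of long
  induced cycles enters the argument.\<close>

lemma neighbours_of_connected_set_adjacent:
  assumes "sym E" "irrefl E"
    and no_cycle: "\<And>n g. 4 \<le> n \<Longrightarrow> \<not> induced_cycle E n g"
    and C: "\<And>c. c \<in> C \<Longrightarrow> c \<noteq> x \<and> (x, c) \<notin> E"
    and conn: "\<And>c d. c \<in> C \<Longrightarrow> d \<in> C \<Longrightarrow> (c, d) \<in> (E \<inter> C \<times> C)\<^sup>*"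
    and u: "(x, u) \<in> E" "c \<in> C" "(u, c) \<in> E"
    and w: "(x, w) \<in> E" "d \<in> C" "(w, d) \<in> E"
    and "u \<noteq> w"
  shows "(u, w) \<in> E"
proof (rule ccontr)
  assume nonadj: "(u, w) \<notin> E"
  define P where "P = insert u (insert w C)"
  \<comment> \<open>Restricting to \<open>P\<close> confines the path to \<open>C\<close> and its
    two ends; between vertices of \<open>P\<close>, chords in \<open>R\<close> and in
    \<open>E\<close> are the same.\<close>
  define R where "R = E \<inter> P \<times> P"
  have "(c, d) \<in> R\<^sup>*"
    using conn[OF u(2) w(2)] rtrancl_mono[of "E \<inter> C \<times> C" R] by (auto simp: R_def P_def)
  moreover have "(u, c) \<in> R" "(d, w) \<in> R"
    using u w symD[OF assms(1) w(3)] by (auto simp: R_def P_def)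
  ultimately have "(u, w) \<in> R\<^sup>*" by (meson converse_rtrancl_into_rtrancl rtrancl.rtrancl_into_rtrancl)
  then obtain f m where f: "f 0 = u" "f m = w" "\<And>i. i < m \<Longrightarrow> (f i, f (Suc i)) \<in> R"
    and inj: "inj_on f {..m}"
    and chordless: "\<And>i j. i < j \<Longrightarrow> j \<le> m \<Longrightarrow> (f i, f j) \<in> R \<Longrightarrow> j = Suc i"
    by (rule shortest_path) blast
  have "m \<noteq> 0" using f(1,2) \<open>u \<noteq> w\<close> by metis
  moreover have "m \<noteq> 1" using f(1,2) f(3)[of 0] nonadj by (auto simp: R_def)
  ultimately have m: "2 \<le> m" by simp
  have P: "f i \<in> P" if "i \<le> m" for i
    using f(3)[of i] f(2) that by (cases "i = m") (auto simp: R_def P_def)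
  have inner: "f i \<in> C" if "0 < i" "i < m" for i
    using P[of i] that inj_onD[OF inj, of i 0] inj_onD[OF inj, of i m] f(1,2)
    by (auto simp: P_def)
  have "induced_cycle E (m + 2) (f(Suc m := x))"
  proof (rule induced_cycle_close_path[OF assms(1,2) inj m])
    show "(f i, f j) \<in> E \<longleftrightarrow> j = Suc i" if "i < j" "j \<le> m" for i j
      using chordless[OF that] f(3)[of i] P[of i] P[of j] that by (auto simp: R_def)
    have ux: "u \<noteq> x" "w \<noteq> x" using u w assms(2) by (auto simp: irrefl_def)
    show "f i \<noteq> x" if "i \<le> m" for i
      using P[OF that] C ux by (auto simp: P_def)
    show "(x, f i) \<in> E \<longleftrightarrow> i = 0 \<or> i = m" if "i \<le> m" for i
      using C[OF inner[of i]] u(1) w(1) f(1,2) that by (cases "i = 0 \<or> i = m") auto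
  qed
  then show False using no_cycle[of "m + 2"] m by simp
qed

section \<open>Existence of simplicial vertices\<close>

text \<open>The vertex \<open>y\<close> only witnesses that \<open>x\<close> is not universal. Both
  vary in the induction, since the smaller set is entered with a different vertex in the role of
  \<open>x\<close>.\<close>

lemma simplicial_nonadjacent_exists:
  assumes "finite W" "sym E" "irrefl E"
    and no_cycle: "\<And>n g. 4 \<le> n \<Longrightarrow> \<not> induced_cycle E n g"
    and "x \<in> W" "y \<in> W" "y \<noteq> x" "(x, y) \<notin> E"
  shows "\<exists>v. simplicial E W v \<and> v \<noteq> x \<and> (x, v) \<notin> E"
  using assms(1,5-)
proof (induction W arbitrary: x y rule: finite_psubset_induct)
  case (psubset W)
  define D where "D = {z \<in> W. z \<noteq> x \<and> (x, z) \<notin> E}"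
  define R where "R = E \<inter> D \<times> D"
  define C where "C = R\<^sup>* `` {y}"
  define T where "T = {t \<in> W. (x, t) \<in> E \<and> (\<exists>c\<in>C. (t, c) \<in> E)}"
  have symE: "(b, a) \<in> E" if "(a, b) \<in> E" for a b
    using assms(2) that by (rule symD)
  have "y \<in> D" "y \<in> C" using psubset.prems by (auto simp: D_def C_def)
  have "z \<in> D" if "(y, z) \<in> R\<^sup>*" for z
    using that by (induction rule: rtrancl_induct) (use \<open>y \<in> D\<close> in \<open>auto simp: R_def\<close>)
  then have CD: "C \<subseteq> D" by (auto simp: C_def)
  have closed: "b \<in> C" if "a \<in> C" "b \<in> D" "(a, b) \<in> E" for a b
    using that CD unfolding C_def by (auto simp: R_def intro: rtrancl_into_rtrancl)
  have conn: "(c, d) \<in> (E \<inter> C \<times> C)\<^sup>*" if "c \<in> C" "d \<in> C" for c d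
  proof -
    \<comment> \<open>Every vertex on an \<open>R\<close>-path from \<open>y\<close> is itself
      reachable from \<open>y\<close>, so the path stays in \<open>C\<close> and not merely in
      \<open>D\<close>.\<close>
    have reach: "(y, z) \<in> (E \<inter> C \<times> C)\<^sup>*" if "z \<in> C" for z
    proof -
      have "(y, z) \<in> R\<^sup>*" using that by (simp add: C_def)
      then show ?thesis
      proof (induction rule: rtrancl_induct)
        case (step a b)
        then have "(a, b) \<in> E \<inter> C \<times> C"
          by (auto simp: C_def R_def intro: rtrancl_into_rtrancl)
        then show ?case using step.IH by (rule rtrancl_into_rtrancl[rotated])
      qed simp
    qed
    have "sym (E \<inter> C \<times> C)" by (intro symI) (blast intro: symE)
    then have "(c, y) \<in> (E \<inter> C \<times> C)\<^sup>*" using reach[OF that(1)] by (meson sym_rtrancl symD)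
    then show ?thesis using reach[OF that(2)] by (rule rtrancl_trans)
  qed
  have T: "clique E T"
    unfolding clique_def
  proof (intro ballI impI)
    fix u w assume "u \<in> T" "w \<in> T" "u \<noteq> w"
    then obtain c d where cd: "(x, u) \<in> E" "c \<in> C" "(u, c) \<in> E" "(x, w) \<in> E" "d \<in> C" "(w, d) \<in> E"
      by (auto simp: T_def)
    have "c \<noteq> x \<and> (x, c) \<notin> E" if "c \<in> C" for c
      using that CD by (auto simp: D_def)
    from neighbours_of_connected_set_adjacent[OF assms(2,3) no_cycle this conn cd \<open>u \<noteq> w\<close>]
    show "(u, w) \<in> E" .
  qed
  define H where "H = C \<union> T"
  have "x \<notin> H" using CD assms(3) by (auto simp: H_def D_def T_def irrefl_def)
  moreover have "H \<subseteq> W" using CD by (auto simp: H_def D_def T_def)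
  ultimately have "H \<subset> W" using psubset.prems by blast
  \<comment> \<open>A neighbour of \<open>C\<close> outside \<open>D\<close> is adjacent to
    \<open>x\<close>, hence in \<open>T\<close>; it cannot be \<open>x\<close> itself. Thus a vertex
    of \<open>C\<close> has the same neighbours in \<open>H\<close> as in \<open>W\<close>.\<close>
  have nbr: "b \<in> H" if "a \<in> C" "b \<in> W" "(a, b) \<in> E" for a b
  proof (cases "b \<in> D")
    case True
    then show ?thesis using closed that by (auto simp: H_def)
  next
    case False
    have "b \<noteq> x" using that(1) symE[OF that(3)] CD by (auto simp: D_def)
    then have "(x, b) \<in> E" using False that(2) by (simp add: D_def)
    then show ?thesis using that(1,2) symE[OF that(3)] unfolding H_def T_def by blast
  qed
  have "\<exists>v\<in>C. simplicial E H v"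
  proof (cases "clique E H")
    case True
    have "y \<in> H" using \<open>y \<in> C\<close> by (simp add: H_def)
    then have "simplicial E H y"
      using clique_subset[OF True, of "H \<inter> E `` {y}"]
      unfolding simplicial_def by (simp add: \<open>y \<in> H\<close>)
    then show ?thesis using \<open>y \<in> C\<close> by blast
  next
    case False
    \<comment> \<open>Picking the non-universal vertex from \<open>T\<close> whenever possible forces the simplicial vertex
      of the induction hypothesis into \<open>C\<close>: it is non-universal itself, and not adjacent to the
      picked vertex although \<open>T\<close> is a clique.\<close>
    define N where "N = {s \<in> H. \<exists>z\<in>H. z \<noteq> s \<and> (s, z) \<notin> E}"
    from False obtain a b where "a \<in> H" "b \<in> H" "a \<noteq> b" "(a, b) \<notin> E"
      unfolding clique_def by blast
    then have "a \<in> N" by (auto simp: N_def)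
    then obtain s where s: "s \<in> N" "N \<inter> T \<noteq> {} \<longrightarrow> s \<in> T"
      by (cases "N \<inter> T = {}") auto
    from s(1) obtain z where "s \<in> H" "z \<in> H" "z \<noteq> s" "(s, z) \<notin> E"
      unfolding N_def by blast
    from psubset.IH[OF \<open>H \<subset> W\<close> this] obtain v where
      v: "simplicial E H v" "v \<noteq> s" "(s, v) \<notin> E" by blast
    from v(1) have "v \<in> H" by (simp add: simplicial_def)
    have "(v, s) \<notin> E" using v(3) symE by blast
    then have "v \<in> N" using v(2) \<open>v \<in> H\<close> \<open>s \<in> H\<close> by (auto simp: N_def)
    then have "v \<notin> T"
      using s(2) v(2,3) cliqueD[OF T, of s v] by blast
    then have "v \<in> C" using \<open>v \<in> H\<close> by (simp add: H_def)
    then show ?thesis using v by blast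
  qed
  then obtain v where v: "v \<in> C" "simplicial E H v" by blast
  have "W \<inter> E `` {v} \<subseteq> H \<inter> E `` {v}" using nbr v(1) by auto
  then have "simplicial E W v"
    using v(2) \<open>H \<subset> W\<close> clique_subset[of E "H \<inter> E `` {v}" "W \<inter> E `` {v}"]
    by (auto simp: simplicial_def)
  then show ?case using v(1) CD by (auto simp: D_def)
qed

text \<open>In a clique every vertex is simplicial; otherwise a non-adjacent pair provides
  \<open>x\<close> and \<open>y\<close>.\<close>

lemma simplicial_exists:
  assumes "finite W" "W \<noteq> {}" "sym E" "irrefl E"
    and "\<And>n g. 4 \<le> n \<Longrightarrow> \<not> induced_cycle E n g"
  shows "\<exists>v. simplicial E W v"
proof (cases "clique E W")
  case True
  then show ?thesis
    using assms(2) clique_subset[OF True] unfolding simplicial_def by blast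
next
  case False
  then obtain x y where "x \<in> W" "y \<in> W" "y \<noteq> x" "(x, y) \<notin> E"
    by (auto simp: clique_def)
  then show ?thesis using simplicial_nonadjacent_exists[OF assms(1,3,4,5)] by blast
qed

section \<open>From enumerated cycles to induced subgraphs\<close>

text \<open>The inverse \<open>h\<close> of the enumeration, applied to both ends of each arc, is
  the required isomorphism onto the cycle.\<close>

lemma has_induced_cycle_graph:
  assumes "pair_graph G" "4 \<le> n" and cyc: "induced_cycle (parcs G) n g"
  shows "has_induced G (cycle_graph n)"
proof -
  interpret pair_graph G by fact
  define S where "S = g ` {0..<n}"
  define h where "h = the_inv_into {0..<n} g"
  have inj: "inj_on g {0..<n}" using cyc by (simp add: induced_cycle_def)
  have adj: "(g i, g j) \<in> parcs G \<longleftrightarrow> (i, j) \<in> parcs (cycle_graph n)" if "i < n" "j < n" for i j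
    using cyc that by (simp add: induced_cycle_def cycle_graph_def)
  have hg: "h (g i) = i" if "i < n" for i
    unfolding h_def using that by (simp add: the_inv_into_f_f[OF inj])
  have h_bij: "bij_betw h S {0..<n}"
    unfolding h_def S_def using inj by (simp add: bij_betw_the_inv_into inj_on_imp_bij_betw)
  \<comment> \<open>\<open>induced_cycle\<close> speaks of arcs only; each \<open>g i\<close> is a
    vertex because it is the tail of the arc to its successor.\<close>
  have "S \<subseteq> pverts G"
  proof
    fix v assume "v \<in> S"
    then obtain i where i: "v = g i" "i < n" by (auto simp: S_def)
    then have "(g i, g (Suc i mod n)) \<in> parcs G"
      by (subst adj) (auto simp: cycle_graph_def)
    then show "v \<in> pverts G" using i in_arcsD1 by blast
  qed
  let ?GS = "with_proj G \<restriction> S"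
  define hom :: "('a, 'a \<times> 'a, nat, nat \<times> nat) digraph_isomorphism" where
    "hom = \<lparr>iso_verts = h, iso_arcs = map_prod h h, iso_head = snd, iso_tail = fst\<rparr>"
  have "pre_digraph.digraph_isomorphism ?GS hom"
    unfolding pre_digraph.digraph_isomorphism_def
  proof (intro conjI)
    show "wf_digraph ?GS" by (rule wellformed_induce_subgraph)
    show "inj_on (iso_verts hom) (verts ?GS)"
      using h_bij by (simp add: hom_def bij_betw_def)
    have "inj_on (map_prod h h) (S \<times> S)"
      using h_bij by (simp add: bij_betw_def map_prod_inj_on)
    then show "inj_on (iso_arcs hom) (arcs ?GS)"
      by (auto simp: hom_def intro: inj_on_subset)
  qed (auto simp: hom_def)
  moreover have "with_proj (cycle_graph n) = app_iso hom ?GS"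
  proof (rule pre_digraph.equality)
    show "verts (with_proj (cycle_graph n)) = verts (app_iso hom ?GS)"
      using h_bij by (simp add: hom_def bij_betw_def cycle_graph_def)
    have "map_prod h h ` {e \<in> parcs G. fst e \<in> S \<and> snd e \<in> S} = parcs (cycle_graph n)"
    proof (intro equalityI subsetI)
      fix e assume "e \<in> map_prod h h ` {e \<in> parcs G. fst e \<in> S \<and> snd e \<in> S}"
      then obtain i j where "e = (h (g i), h (g j))" "i < n" "j < n" "(g i, g j) \<in> parcs G"
        by (auto simp: S_def)
      then show "e \<in> parcs (cycle_graph n)" using adj hg by simp
    next
      fix e assume e: "e \<in> parcs (cycle_graph n)"
      obtain i j where ij: "e = (i, j)" by (cases e)
      then have "i < n" "j < n" using e by (auto simp: cycle_graph_def)
      then have "(g i, g j) \<in> {e \<in> parcs G. fst e \<in> S \<and> snd e \<in> S}"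
        using adj e ij by (auto simp: S_def)
      moreover have "e = map_prod h h (g i, g j)" using \<open>i < n\<close> \<open>j < n\<close> hg ij by simp
      ultimately show "e \<in> map_prod h h ` {e \<in> parcs G. fst e \<in> S \<and> snd e \<in> S}" by blast
    qed
    then show "arcs (with_proj (cycle_graph n)) = arcs (app_iso hom ?GS)"
      by (simp add: hom_def)
  qed (simp_all add: hom_def)
  ultimately have "digraph_iso ?GS (with_proj (cycle_graph n))"
    unfolding digraph_iso_def by blast
  then show ?thesis using \<open>S \<subseteq> pverts G\<close> unfolding has_induced_def by blast
qed

section \<open>Cliques and the Grundy number\<close>

text \<open>Some Grundy coloring exists, and being proper it is injective on \<open>K\<close>; its
  number of colors is at most the maximum over all such colorings.\<close>

lemma card_clique_le_chi_FF:
  assumes "simple_graph G" "K \<subseteq> pverts G" "clique (parcs G) K"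
  shows "card K \<le> chi_FF G"
proof -
  let ?A = "{k. \<exists>c. grundy_coloring G k c}"
  obtain k c where c: "grundy_coloring G k c"
    using grundy_coloring_exists[OF assms(1)] by blast
  have "c u \<noteq> c v" if "(u, v) \<in> parcs G" for u v
    using c that unfolding grundy_coloring_def by blast
  then have "inj_on c K"
    using cliqueD[OF assms(3)] by (meson inj_onI)
  moreover have "c ` K \<subseteq> {1..k}"
    using c assms(2) by (auto simp: grundy_coloring_def)
  ultimately have "card K \<le> k"
    using card_inj_on_le[of c K "{1..k}"] by simp
  also have "k \<le> chi_FF G"
    unfolding chi_FF_def using c by (intro Max_ge finite_grundy_numbers assms(1)) auto
  finally show ?thesis .
qed

lemma chordal_min_degree_less_chi_FF:
  assumes "chordal G"
  shows "min_degree G + 1 \<le> chi_FF G"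
proof -
  have simple: "simple_graph G"
    and no_cycle: "\<And>n. 4 \<le> n \<Longrightarrow> \<not> has_induced G (cycle_graph n)"
    using assms by (auto simp: chordal_def Forb_def)
  have "pair_graph G" using simple by (simp add: simple_graph_def)
  then interpret pair_graph G .
  have "sym (parcs G)" by (auto intro: symI arcs_symmetric)
  have "irrefl (parcs G)" using no_loops' by (auto simp: irrefl_def)
  obtain v where v: "simplicial (parcs G) (pverts G) v"
    using simplicial_exists[OF pair_finite_verts _ \<open>sym _\<close> \<open>irrefl _\<close>]
      has_induced_cycle_graph[OF \<open>pair_graph G\<close>] no_cycle simple
    by (auto simp: simple_graph_def)
  let ?N = "parcs G `` {v}"
  have N: "?N \<subseteq> pverts G" using in_arcsD2 by auto
  have "v \<notin> ?N" using no_loops' by auto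
  have "min_degree G \<le> out_degree (with_proj G) v"
    unfolding min_degree_def using v by (intro Min_le) (auto simp: simplicial_def)
  \<comment> \<open>\<open>out_degree\<close> counts arcs; pairing with \<open>v\<close> turns the
    count into one of neighbours.\<close>
  also have "out_arcs (with_proj G) v = Pair v ` ?N" by (auto simp: out_arcs_def)
  then have "out_degree (with_proj G) v = card ?N"
    by (simp add: out_degree_def card_image inj_on_def)
  finally have "min_degree G + 1 \<le> card (insert v ?N)"
    using \<open>v \<notin> ?N\<close> finite_subset[OF N pair_finite_verts] by simp
  \<comment> \<open>Simpliciality covers pairs of neighbours, symmetry the edges back to
    \<open>v\<close>.\<close>
  also have "clique (parcs G) (insert v ?N)"
    using v N \<open>sym (parcs G)\<close> by (auto simp: simplicial_def clique_def dest: symD)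
  then have "card (insert v ?N) \<le> chi_FF G"
    using N v by (intro card_clique_le_chi_FF simple) (auto simp: simplicial_def)
  finally show ?thesis .
qed

theorem theorem8:
  shows "delta_FF_bounded_by (\<lambda>x. x + 1)
           (Forb {cycle_graph n | n. n \<ge> 4} :: 'a pair_pre_digraph set) \<and>
         (\<forall>G :: 'a pair_pre_digraph. chordal G \<longrightarrow> chi_FF G \<ge> min_degree G + 1)"
proof -
  have "filterlim (\<lambda>x::nat. x + 1) at_top at_top"
    using filterlim_Suc by simp
  then show ?thesis
    using chordal_min_degree_less_chi_FF unfolding delta_FF_bounded_by_def chordal_def by blast
qed

end
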